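(* For all $u,v\in\mathbb{C}$ with $|uv|<1$ and all $(z,w)\in\mathbb{C}^2$, $$\sum_{m=0}^{+\infty}\sum_{n=0}^{+\infty}\frac{u^mv^n}{m!\,n!}H_{m,n,m,n}(z,w)=\frac{1}{1-uv}\exp\left(\frac{(u+v-2uv)|z|^2-(u+v+2uv)|w|^2+2i(u-v)\,\mathrm{Re}(z\overline{w})}{1-uv}\right).$$
   Context: For integers $m,n\ge 0$ and $\zeta\in\mathbb{C}$, $H_{m,n}(\zeta,\overline{\zeta})=(-1)^{m+n}e^{|\zeta|^2}\frac{\partial^{m+n}}{\partial\overline{\zeta}^{m}\partial\zeta^{n}}\left(e^{-|\zeta|^2}\right)$ (Wirtinger derivatives), and for $(z,w)\in\mathbb{C}^2$, $H_{m,n,m',n'}(z,w)=H_{m,n}(z+iw,\overline{z}-i\overline{w})\,H_{m',n'}(\overline{z}+i\overline{w},z-iw)$. *)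

theory Defs
  imports "HOL-Analysis.Analysis"
begin

definition partial_x :: "(complex \<Rightarrow> complex) \<Rightarrow> complex \<Rightarrow> complex" where
  "partial_x f \<zeta> = vector_derivative (\<lambda>t::real. f (\<zeta> + of_real t)) (at 0)"

definition partial_y :: "(complex \<Rightarrow> complex) \<Rightarrow> complex \<Rightarrow> complex" where
  "partial_y f \<zeta> = vector_derivative (\<lambda>t::real. f (\<zeta> + \<i> * of_real t)) (at 0)"

definition wirtinger :: "(complex \<Rightarrow> complex) \<Rightarrow> complex \<Rightarrow> complex" where
  "wirtinger f \<zeta> = (partial_x f \<zeta> - \<i> * partial_y f \<zeta>) / 2"

definition wirtinger_bar :: "(complex \<Rightarrow> complex) \<Rightarrow> complex \<Rightarrow> complex" where
  "wirtinger_bar f \<zeta> = (partial_x f \<zeta> + \<i> * partial_y f \<zeta>) / 2"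

(* The second argument of H_{m,n}(\<zeta>, cnj \<zeta>) is always the conjugate of the first, so only
   \<zeta> is kept as an argument. *)
definition complex_hermite :: "nat \<Rightarrow> nat \<Rightarrow> complex \<Rightarrow> complex" where
  "complex_hermite m n \<zeta> =
     (-1) ^ (m + n) * exp (of_real ((cmod \<zeta>)\<^sup>2)) *
     (wirtinger_bar ^^ m) ((wirtinger ^^ n) (\<lambda>\<xi>. exp (- of_real ((cmod \<xi>)\<^sup>2)))) \<zeta>"

(* H_{m,n,m',n'}(z,w) = H_{m,n}(z + iw, cnj z - i cnj w) H_{m',n'}(cnj z + i cnj w, z - iw);
   in both factors the omitted second argument is the conjugate of the first. *)
definition complex_hermite2 ::
  "nat \<Rightarrow> nat \<Rightarrow> nat \<Rightarrow> nat \<Rightarrow> complex \<Rightarrow> complex \<Rightarrow> complex" where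
  "complex_hermite2 m n m' n' z w =
     complex_hermite m n (z + \<i> * w) * complex_hermite m' n' (cnj z + \<i> * cnj w)"

end

theory Submission imports Defs begin

text \<open>
  Expand only the second factor of \<open>H m n a b * H m n c d\<close> into monomials and put \<open>m = l + p\<close>,
  \<open>n = l + q\<close>, where \<open>l\<close> is the index of the expansion. For fixed \<open>l\<close> the sum over \<open>p, q\<close> is the
  exponential generating function of the shifted polynomials \<open>H (l + p) (l + q) a b\<close>, which is an
  exponential times \<open>H l l\<close> at a shifted point; the remaining sum over \<open>l\<close> is a Laguerre-type
  generating function, evaluated by the negative binomial series. Flipping the sign of the parameter
  \<open>e\<close> below makes all coefficients positive, so the same formulas over the reals show absolute
  convergence and justify every rearrangement.
\<close>

section \<open>Ito--Hermite polynomials\<close>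

text \<open>The Hermite polynomials of the statement are the case \<open>e = -1\<close>; \<open>e \<ge> 0\<close> serves for majorants.\<close>

definition ito :: "'a \<Rightarrow> nat \<Rightarrow> nat \<Rightarrow> 'a \<Rightarrow> 'a \<Rightarrow> 'a::real_normed_field" where
  "ito e m n a b =
     (\<Sum>k\<le>m. of_nat (m choose k) * of_nat (n choose k) * fact k * e ^ k * a ^ (m - k) * b ^ (n - k))"

text \<open>\<open>n choose k\<close> vanishes for \<open>k > n\<close>. The range symmetric in
  \<open>m\<close> and \<open>n\<close> gives \<open>ito_swap\<close> and fits the reindexing in
  \<open>ito_mehler\<close>.\<close>

lemma ito_min:
  "ito e m n a b =
     (\<Sum>k\<le>min m n. of_nat (m choose k) * of_nat (n choose k) * fact k * e ^ k * a ^ (m - k) * b ^ (n - k))"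
  unfolding ito_def by (rule sum.mono_neutral_right) auto

lemma ito_swap: "ito e m n a b = ito e n m b a"
  unfolding ito_min by (simp add: min.commute ac_simps)

lemma ito_0_left [simp]: "ito e 0 n a b = b ^ n"
  by (simp add: ito_def)

text \<open>Pascal's rule in \<open>m\<close> plus absorption in \<open>n\<close>. The truncated
  \<open>n - 1\<close> is harmless at \<open>n = 0\<close> because of the factor
  \<open>of_nat n\<close>. Both the generating functions and the Wirtinger derivatives are driven by
  this recursion.\<close>

lemma ito_Suc_left:
  "ito e (Suc m) n a b = a * ito e m n a b + e * of_nat n * ito e m (n - 1) a b"
proof -
  define t where "t k = of_nat (n choose k) * fact k * e ^ k * b ^ (n - k)" for k
  have t_Suc: "t (Suc k) = e * of_nat n * (of_nat ((n - 1) choose k) * fact k * e ^ k * b ^ (n - 1 - k))" for k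
  proof (cases n)
    case (Suc n')
    have "of_nat (Suc k) * of_nat (Suc n' choose Suc k) = (of_nat (Suc n') * of_nat (n' choose k) :: 'a)"
      by (metis Suc_times_binomial_eq mult.commute of_nat_mult)
    then show ?thesis
      by (simp add: t_def Suc mult_ac del: of_nat_Suc binomial_Suc_Suc)
  qed (simp add: t_def)
  have "ito e (Suc m) n a b = (\<Sum>k\<le>Suc m. of_nat (Suc m choose k) * t k * a ^ (Suc m - k))"
    unfolding ito_def t_def by (simp only: mult_ac)
  also have "\<dots> = t 0 * a ^ Suc m + (\<Sum>k\<le>m. of_nat (Suc m choose Suc k) * t (Suc k) * a ^ (m - k))"
    by (subst sum.atMost_Suc_shift) simp
  also have "\<dots> = (t 0 * a ^ Suc m + (\<Sum>k\<le>m. of_nat (m choose Suc k) * t (Suc k) * a ^ (m - k)))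
      + (\<Sum>k\<le>m. of_nat (m choose k) * t (Suc k) * a ^ (m - k))"
    by (simp add: sum.distrib algebra_simps)
  \<comment> \<open>The top term \<open>k = Suc m\<close> carries \<open>m choose Suc m = 0\<close>,
    so it can be kept here and dropped in the next step.\<close>
  also have "t 0 * a ^ Suc m + (\<Sum>k\<le>m. of_nat (m choose Suc k) * t (Suc k) * a ^ (m - k))
      = (\<Sum>k\<le>Suc m. of_nat (m choose k) * t k * a ^ (Suc m - k))"
    by (simp only: sum.atMost_Suc_shift) simp
  also have "\<dots> = a * ito e m n a b"
    by (simp add: ito_def t_def sum_distrib_left Suc_diff_le mult_ac)
  also have "(\<Sum>k\<le>m. of_nat (m choose k) * t (Suc k) * a ^ (m - k)) = e * of_nat n * ito e m (n - 1) a b"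
    by (simp add: ito_def t_Suc sum_distrib_left mult_ac)
  finally show ?thesis .
qed

text \<open>Triangle inequality. The majorant is again an \<open>ito\<close>, now over the reals
  with parameter \<open>norm e\<close>, so its sums come from the same formulas.\<close>

lemma norm_ito_le: "norm (ito e m n a b) \<le> ito (norm e) m n (norm a) (norm b)"
  unfolding ito_def by (rule sum_norm_le) (simp add: norm_mult norm_power)

section \<open>Generating functions\<close>

text \<open>Tonelli for the majorant \<open>F\<close>, nonnegative by \<open>le\<close>, gives
  absolute summability of \<open>f\<close>; Fubini then turns the iterated sum into a sum over
  pairs.\<close>

lemma has_sum_SigmaI_dominated:
  fixes f :: "'a \<times> 'b \<Rightarrow> 'c::banach" and F :: "'a \<times> 'b \<Rightarrow> real"
  assumes F: "\<And>x. x \<in> A \<Longrightarrow> ((\<lambda>y. F (x, y)) has_sum G x) (B x)" and G: "G summable_on A"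
    and le: "\<And>x y. x \<in> A \<Longrightarrow> y \<in> B x \<Longrightarrow> norm (f (x, y)) \<le> F (x, y)"
    and f: "\<And>x. x \<in> A \<Longrightarrow> ((\<lambda>y. f (x, y)) has_sum g x) (B x)" and g: "(g has_sum S) A"
  shows "(f has_sum S) (Sigma A B)"
proof (rule has_sum_SigmaI [OF f g])
  have "F summable_on Sigma A B"
    by (rule summable_on_SigmaI [OF F G]) (use le norm_ge_zero order_trans in blast)+
  then have "(\<lambda>x. norm (f x)) summable_on Sigma A B"
    by (rule Infinite_Sum.abs_summable_on_comparison_test') (use le in auto)
  then show "f summable_on Sigma A B"
    by (rule abs_summable_summable)
qed

lemma exp_has_sum: "((\<lambda>n. x ^ n / fact n) has_sum exp x) UNIV"
  for x :: "'a::{real_normed_field,banach}"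
proof -
  have eq: "x ^ n / fact n = x ^ n /\<^sub>R fact n" for n
    by (simp add: scaleR_conv_of_real field_simps)
  show ?thesis
    unfolding eq by (rule norm_summable_imp_has_sum [OF summable_norm_exp exp_converges])
qed

text \<open>Since \<open>q / fact q = 1 / fact (q - 1)\<close> for \<open>q > 0\<close>, the index
  shift multiplies the exponential generating function by \<open>t\<close>; the term
  \<open>q = 0\<close> vanishes.\<close>

lemma has_sum_exp_shift:
  fixes t :: "'a::{real_normed_field,banach}"
  assumes "((\<lambda>q. t ^ q / fact q * f q) has_sum S) UNIV"
  shows "((\<lambda>q. t ^ q / fact q * (of_nat q * f (q - 1))) has_sum t * S) UNIV"
proof -
  have "((\<lambda>q. t * (t ^ q / fact q * f q)) has_sum t * S) UNIV"
    by (rule has_sum_cmult_right [OF assms])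
  also have "?this \<longleftrightarrow> ((\<lambda>q. t ^ q / fact q * (of_nat q * f (q - 1))) has_sum t * S) {1..}"
    by (rule has_sum_reindex_bij_witness [of _ "\<lambda>q. q - 1" Suc])
       (auto simp: divide_simps simp del: of_nat_Suc)
  also have "\<dots> \<longleftrightarrow> ((\<lambda>q. t ^ q / fact q * (of_nat q * f (q - 1))) has_sum t * S) UNIV"
    by (rule has_sum_cong_neutral) (auto simp: not_le)
  finally show ?thesis .
qed

text \<open>Induction on \<open>m\<close> by \<open>ito_Suc_left\<close>, whose factor
  \<open>n + q\<close> is split: the \<open>n\<close> part stays as it is, while the
  \<open>q\<close> part is an index shift and yields \<open>e * t\<close>, which moves
  \<open>a\<close> to \<open>a + e * t\<close>.\<close>

lemma ito_gen_right:
  fixes t :: "'a::{real_normed_field,banach}"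
  shows "((\<lambda>q. t ^ q / fact q * ito e m (n + q) a b) has_sum exp (t * b) * ito e m n (a + e * t) b) UNIV"
proof (induction m arbitrary: n)
  case 0
  have "((\<lambda>q. b ^ n * ((t * b) ^ q / fact q)) has_sum b ^ n * exp (t * b)) UNIV"
    by (rule has_sum_cmult_right [OF exp_has_sum])
  then show ?case
    by (simp add: power_add power_mult_distrib mult_ac)
next
  case (Suc m)
  let ?S = "\<lambda>n. exp (t * b) * ito e m n (a + e * t) b"
  have "((\<lambda>q. a * (t ^ q / fact q * ito e m (n + q) a b)
          + (e * of_nat n * (t ^ q / fact q * ito e m (n - 1 + q) a b)
          + e * (t ^ q / fact q * (of_nat q * ito e m (n + (q - 1)) a b))))
        has_sum a * ?S n + (e * of_nat n * ?S (n - 1) + e * (t * ?S n))) UNIV"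
    by (intro has_sum_add has_sum_cmult_right has_sum_exp_shift Suc.IH)
  also have "(\<lambda>q. a * (t ^ q / fact q * ito e m (n + q) a b)
          + (e * of_nat n * (t ^ q / fact q * ito e m (n - 1 + q) a b)
          + e * (t ^ q / fact q * (of_nat q * ito e m (n + (q - 1)) a b)))) =
        (\<lambda>q. t ^ q / fact q * ito e (Suc m) (n + q) a b)" (is "?f = ?g")
  proof
    fix q
    \<comment> \<open>The truncated differences may disagree at \<open>n = 0\<close>, where the
      factor \<open>of_nat n\<close> kills both sides; likewise for \<open>q\<close> below.\<close>
    have "of_nat n * ito e m (n - 1 + q) a b = of_nat n * ito e m (n + q - 1) a b"
      by (cases n) auto
    moreover have "of_nat q * ito e m (n + (q - 1)) a b = of_nat q * ito e m (n + q - 1) a b"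
      by (cases q) auto
    moreover have "?f q = t ^ q / fact q * (a * ito e m (n + q) a b
        + e * (of_nat n * ito e m (n - 1 + q) a b + of_nat q * ito e m (n + (q - 1)) a b))"
      by (simp only: ring_distribs mult_ac)
    ultimately show "?f q = ?g q"
      by (simp only: ito_Suc_left of_nat_add ring_distribs mult_ac)
  qed
  also have "a * ?S n + (e * of_nat n * ?S (n - 1) + e * (t * ?S n))
      = exp (t * b) * ito e (Suc m) n (a + e * t) b"
    by (simp add: ito_Suc_left algebra_simps)
  finally show ?case .
qed

lemma ito_gen_left:
  fixes s :: "'a::{real_normed_field,banach}"
  shows "((\<lambda>p. s ^ p / fact p * ito e (m + p) n a b) has_sum exp (s * a) * ito e m n a (b + e * s)) UNIV"
  using ito_gen_right [of s e n m b a] by (simp only: ito_swap [of e n] ito_swap [of _ n])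

text \<open>Sum over \<open>q\<close> first, then over \<open>p\<close> at the shifted point
  \<open>a + e * t\<close>; the cross term \<open>e * s * t\<close> comes from
  \<open>exp (s * (a + e * t))\<close>.\<close>

lemma ito_gen:
  fixes s t :: "'a::{real_normed_field,banach}"
  shows "((\<lambda>(p, q). s ^ p / fact p * (t ^ q / fact q) * ito e (m + p) (n + q) a b)
    has_sum exp (s * a + t * b + e * s * t) * ito e m n (a + e * t) (b + e * s)) UNIV"
proof -
  \<comment> \<open>\<open>inner\<close> and \<open>outer\<close> range over an arbitrary field
    type, so that the sum itself and its real majorant are both instances.\<close>
  have inner: "((\<lambda>q. s ^ p / fact p * (t ^ q / fact q) * ito e (m + p) (n + q) a b)
      has_sum exp (t * b) * (s ^ p / fact p * ito e (m + p) n (a + e * t) b)) UNIV"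
    for s t e a b :: "'b::{real_normed_field,banach}" and p
    using has_sum_cmult_right [OF ito_gen_right [of t e "m + p" n a b], of "s ^ p / fact p"]
    by (simp add: mult_ac)
  have outer: "((\<lambda>p. exp (t * b) * (s ^ p / fact p * ito e (m + p) n (a + e * t) b))
      has_sum exp (s * a + t * b + e * s * t) * ito e m n (a + e * t) (b + e * s)) UNIV"
    for s t e a b :: "'b::{real_normed_field,banach}"
    using has_sum_cmult_right [OF ito_gen_left [of s e m n "a + e * t" b], of "exp (t * b)"]
    by (simp add: exp_add algebra_simps)
  have "((\<lambda>(p, q). s ^ p / fact p * (t ^ q / fact q) * ito e (m + p) (n + q) a b)
    has_sum exp (s * a + t * b + e * s * t) * ito e m n (a + e * t) (b + e * s)) (UNIV \<times> UNIV)"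
  proof (rule has_sum_SigmaI_dominated)
    let ?F = "\<lambda>(p, q). norm s ^ p / fact p * (norm t ^ q / fact q)
        * ito (norm e) (m + p) (n + q) (norm a) (norm b)"
    show "norm (case (p, q) of (p, q) \<Rightarrow>
        s ^ p / fact p * (t ^ q / fact q) * ito e (m + p) (n + q) a b) \<le> ?F (p, q)" for p q
      unfolding norm_mult prod.case
      by (rule mult_mono) (simp_all add: norm_divide norm_power norm_ito_le)
    show "((\<lambda>q. ?F (p, q)) has_sum exp (norm t * norm b) * (norm s ^ p / fact p * ito (norm e) (m + p) n
        (norm a + norm e * norm t) (norm b))) UNIV" for p
      unfolding prod.case by (rule inner)
    show "(\<lambda>p. exp (norm t * norm b) * (norm s ^ p / fact p * ito (norm e) (m + p) n
        (norm a + norm e * norm t) (norm b))) summable_on UNIV"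
      by (rule has_sum_imp_summable, rule outer)
    show "((\<lambda>q. case (p, q) of (p, q) \<Rightarrow>
        s ^ p / fact p * (t ^ q / fact q) * ito e (m + p) (n + q) a b) has_sum
        exp (t * b) * (s ^ p / fact p * ito e (m + p) n (a + e * t) b)) UNIV" for p
      unfolding prod.case by (rule inner)
  qed (rule outer)
  then show ?thesis by simp
qed

lemma sum_choose_add_diag: "(\<Sum>i\<le>k. (i + j) choose i) = (k + Suc j) choose k"
  using sum_choose_lower [of j k] by (simp add: add.commute)

text \<open>By the hockey-stick identity \<open>sum_choose_add_diag\<close>, a Cauchy product with
  the geometric series raises \<open>j\<close> by one.\<close>

lemma neg_binomial_summable:
  fixes r :: real
  assumes "0 \<le> r" "r < 1"
  shows "summable (\<lambda>k. of_nat ((k + j) choose k) * r ^ k)"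
proof (induction j)
  case 0
  then show ?case using assms by (simp add: summable_geometric)
next
  case (Suc j)
  have "summable (\<lambda>k. \<Sum>i\<le>k. (of_nat ((i + j) choose i) * r ^ i) * r ^ (k - i))"
    by (rule summable_Cauchy_product) (use Suc assms in \<open>simp_all add: abs_mult summable_geometric\<close>)
  also have "(\<lambda>k. \<Sum>i\<le>k. (of_nat ((i + j) choose i) * r ^ i) * r ^ (k - i))
      = (\<lambda>k. of_nat ((k + Suc j) choose k) * r ^ k)"
    by (simp add: mult.assoc del: add_Suc_right
        flip: power_add sum_choose_add_diag sum_distrib_right)
  finally show ?case .
qed

text \<open>The same Cauchy product, now tracking the value; the real case supplies the absolute
  convergence that the product requires.\<close>

lemma neg_binomial_has_sum:
  fixes y :: "'a::{real_normed_field,banach}"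
  assumes y: "norm y < 1"
  shows "((\<lambda>k. of_nat ((k + j) choose k) * y ^ k) has_sum 1 / (1 - y) ^ Suc j) UNIV"
proof (rule norm_summable_imp_has_sum)
  show sm: "summable (\<lambda>k. norm (of_nat ((k + j) choose k) * y ^ k))" for j
    using neg_binomial_summable [of "norm y" j] y by (simp add: norm_mult norm_power)
  show "(\<lambda>k. of_nat ((k + j) choose k) * y ^ k) sums (1 / (1 - y) ^ Suc j)"
  proof (induction j)
    case 0
    then show ?case using geometric_sums [OF y] by simp
  next
    case (Suc j)
    have "(\<lambda>k. \<Sum>i\<le>k. (of_nat ((i + j) choose i) * y ^ i) * y ^ (k - i)) sums
        ((\<Sum>k. of_nat ((k + j) choose k) * y ^ k) * (\<Sum>k. y ^ k))"
      using y by (intro Cauchy_product_sums sm) (simp add: norm_power summable_geometric)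
    also have "(\<lambda>k. \<Sum>i\<le>k. (of_nat ((i + j) choose i) * y ^ i) * y ^ (k - i))
        = (\<lambda>k. of_nat ((k + Suc j) choose k) * y ^ k)"
      by (simp add: mult.assoc del: add_Suc_right
        flip: power_add sum_choose_add_diag sum_distrib_right)
    also have "(\<Sum>k. of_nat ((k + j) choose k) * y ^ k) * (\<Sum>k. y ^ k) = 1 / (1 - y) ^ Suc (Suc j)"
      using Suc geometric_sums [OF y] by (simp add: sums_iff)
    finally show ?case .
  qed
qed

text \<open>The Laguerre generating function. With \<open>l = j + k\<close>,
  \<open>y = e * x\<close> and \<open>c = x * a * b\<close>, the terms are those of a negative
  binomial series in \<open>k\<close>, which leaves an exponential series in \<open>j\<close> with
  argument \<open>c / (1 - y)\<close>.\<close>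

lemma ito_diagonal_gen:
  fixes x :: "'a::{real_normed_field,banach}"
  assumes y: "norm (e * x) < 1"
  shows "((\<lambda>l. x ^ l / fact l * ito e l l a b) has_sum exp (x * a * b / (1 - e * x)) / (1 - e * x)) UNIV"
proof -
  have inner: "((\<lambda>k. of_nat ((k + j) choose k) * y ^ k * (c ^ j / fact j))
      has_sum (c / (1 - y)) ^ j / fact j * (1 / (1 - y))) UNIV"
    if "norm y < 1" for y c :: "'b::{real_normed_field,banach}" and j
    using has_sum_cmult_left [OF neg_binomial_has_sum [OF that, of j], of "c ^ j / fact j"]
    by (simp add: power_divide mult_ac)
  have outer: "((\<lambda>j. (c / (1 - y)) ^ j / fact j * (1 / (1 - y))) has_sum exp (c / (1 - y)) / (1 - y)) UNIV"
    for y c :: "'b::{real_normed_field,banach}"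
    using has_sum_cmult_left [OF exp_has_sum [of "c / (1 - y)"], of "1 / (1 - y)"] by simp
  define y c where "y = e * x" and "c = x * a * b"
  have "((\<lambda>(j, k). of_nat ((k + j) choose k) * y ^ k * (c ^ j / fact j))
      has_sum exp (c / (1 - y)) / (1 - y)) (UNIV \<times> UNIV)"
  proof (rule has_sum_SigmaI_dominated)
    let ?f = "\<lambda>(j, k). of_nat ((k + j) choose k) * y ^ k * (c ^ j / fact j)"
    let ?F = "\<lambda>(j, k). of_nat ((k + j) choose k) * norm y ^ k * (norm c ^ j / fact j)"
    show "norm (?f (j, k)) \<le> ?F (j, k)" for j k
      by (simp add: norm_mult norm_divide norm_power)
    have y: "norm y < 1" "norm (norm y) < 1"
      using assms by (simp_all add: y_def)
    show "((\<lambda>k. ?F (j, k)) has_sum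
        (norm c / (1 - norm y)) ^ j / fact j * (1 / (1 - norm y))) UNIV" for j
      unfolding prod.case by (rule inner [OF y(2)])
    show "((\<lambda>k. ?f (j, k)) has_sum
        (c / (1 - y)) ^ j / fact j * (1 / (1 - y))) UNIV" for j
      unfolding prod.case by (rule inner [OF y(1)])
    show "(\<lambda>j. (norm c / (1 - norm y)) ^ j / fact j * (1 / (1 - norm y))) summable_on UNIV"
      by (rule has_sum_imp_summable, rule outer)
  qed (rule outer)
  also have "?this \<longleftrightarrow>
      ((\<lambda>(l, k). of_nat (l choose k) * y ^ k * (c ^ (l - k) / fact (l - k)))
        has_sum exp (c / (1 - y)) / (1 - y)) (SIGMA l:UNIV. {..l})"
    by (rule has_sum_reindex_bij_witness [of _ "\<lambda>(l, k). (l - k, k)" "\<lambda>(j, k). (k + j, k)"]) auto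
  finally have "((\<lambda>l. \<Sum>k\<le>l. of_nat (l choose k) * y ^ k * (c ^ (l - k) / fact (l - k)))
      has_sum exp (c / (1 - y)) / (1 - y)) UNIV"
    by (rule has_sum_SigmaD) (simp add: has_sum_finite)
  also have "(\<lambda>l. \<Sum>k\<le>l. of_nat (l choose k) * y ^ k * (c ^ (l - k) / fact (l - k)))
      = (\<lambda>l. x ^ l / fact l * ito e l l a b)"
    unfolding ito_def sum_distrib_left
  proof (intro ext sum.cong refl)
    fix l k :: nat assume "k \<in> {..l}"
    then have k: "k \<le> l" by simp
    then have xl: "x ^ l = x ^ k * x ^ (l - k)"
      by (simp flip: power_add)
    \<comment> \<open>One of the two equal binomials cancels against \<open>fact k / fact l\<close>;
      the other is the negative binomial coefficient.\<close>
    have "of_nat (l choose k) * fact k / fact l = (1 / fact (l - k) :: 'a)"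
      using k by (simp add: binomial_fact)
    then have "of_nat (l choose k) * (of_nat (l choose k) * fact k / fact l) * (y ^ k * c ^ (l - k))
       = of_nat (l choose k) * y ^ k * (c ^ (l - k) / fact (l - k))"
      by simp
    then show "of_nat (l choose k) * y ^ k * (c ^ (l - k) / fact (l - k)) =
        x ^ l / fact l * (of_nat (l choose k) * of_nat (l choose k) * fact k * e ^ k * a ^ (l - k) * b ^ (l - k))"
      by (simp add: y_def c_def power_mult_distrib xl mult_ac)
  qed
  finally show ?thesis by (simp add: y_def c_def)
qed

section \<open>Mehler's formula\<close>

lemma ito_mehler:
  fixes u v a b c d :: "'a::{real_normed_field,banach}"
  assumes uv: "norm (u * v) < 1"
  shows "((\<lambda>(m, n). u ^ m * v ^ n / (fact m * fact n) * (ito (-1) m n a b * ito (-1) m n c d))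
    has_sum exp ((u * a * c + v * b * d - u * v * (a * b + c * d)) / (1 - u * v)) / (1 - u * v)) UNIV"
    (is "(_ has_sum ?R) _")
proof -
  have inner: "((\<lambda>(p, q). x ^ l / fact l * (s ^ p / fact p * (t ^ q / fact q) * ito e (l + p) (l + q) a b))
      has_sum exp (s * a + t * b + e * s * t) * (x ^ l / fact l * ito e l l (a + e * t) (b + e * s))) UNIV"
    for x s t e a b :: "'b::{real_normed_field,banach}" and l :: nat
    using has_sum_cmult_right [OF ito_gen [of s t e l l a b], of "x ^ l / fact l"]
    by (simp add: mult_ac case_prod_unfold)
  have outer: "((\<lambda>l. exp (s * a + t * b + e * s * t) * (x ^ l / fact l * ito e l l (a + e * t) (b + e * s)))
      has_sum exp (s * a + t * b + e * s * t) *
        (exp (x * (a + e * t) * (b + e * s) / (1 - e * x)) / (1 - e * x))) UNIV"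
    if "norm (e * x) < 1" for x s t e a b :: "'b::{real_normed_field,banach}"
    by (intro has_sum_cmult_right ito_diagonal_gen that)
  \<comment> \<open>At expansion index \<open>l\<close>, with \<open>m = l + p\<close> and
    \<open>n = l + q\<close>, the factor \<open>u ^ m * v ^ n * (-1) ^ l * c ^ p * d ^ q\<close>
    equals \<open>x ^ l * s ^ p * t ^ q\<close>. For \<open>e = -1\<close> the ratio
    \<open>e * x\<close> is \<open>u * v\<close>.\<close>
  define x s t where "x = - (u * v)" and "s = u * c" and "t = v * d"
  let ?T = "\<lambda>(l, p, q). x ^ l / fact l * (s ^ p / fact p * (t ^ q / fact q) * ito (-1) (l + p) (l + q) a b)"
  have ne: "1 - u * v \<noteq> 0"
    using uv by force
  have "(s * a + t * b + -1 * s * t) + x * (a + -1 * t) * (b + -1 * s) / (1 - -1 * x)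
      = (u * a * c + v * b * d - u * v * (a * b + c * d)) / (1 - u * v)"
    using ne
    by (subst add_divide_eq_iff)
      (simp_all add: x_def s_def t_def divide_simps, simp_all add: algebra_simps)
  then have R: "exp (s * a + t * b + -1 * s * t) *
        (exp (x * (a + -1 * t) * (b + -1 * s) / (1 - -1 * x)) / (1 - -1 * x)) = ?R"
    by (simp add: x_def flip: exp_add)
  have "(?T has_sum ?R) (UNIV \<times> UNIV)"
    unfolding R [symmetric]
  proof (rule has_sum_SigmaI_dominated)
    \<comment> \<open>The majorant has parameter \<open>1\<close>; its ratio is
      \<open>norm x = norm (u * v)\<close>, so it converges under the same hypothesis.\<close>
    let ?F = "\<lambda>(l, p, q). norm x ^ l / fact l *
        (norm s ^ p / fact p * (norm t ^ q / fact q) * ito 1 (l + p) (l + q) (norm a) (norm b))"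
    show "norm (?T (l, pq)) \<le> ?F (l, pq)" for l pq
      using norm_ito_le [of "-1" "l + fst pq" "l + snd pq" a b]
      by (auto simp: norm_mult norm_divide norm_power case_prod_unfold
          intro!: mult_left_mono divide_right_mono)
    show "((\<lambda>pq. ?F (l, pq)) has_sum exp (norm s * norm a + norm t * norm b + 1 * norm s * norm t) *
        (norm x ^ l / fact l * ito 1 l l (norm a + 1 * norm t) (norm b + 1 * norm s))) UNIV" for l
      unfolding prod.case by (rule inner)
    show "(\<lambda>l. exp (norm s * norm a + norm t * norm b + 1 * norm s * norm t) *
        (norm x ^ l / fact l * ito 1 l l (norm a + 1 * norm t) (norm b + 1 * norm s))) summable_on UNIV"
      by (rule has_sum_imp_summable, rule outer) (use uv in \<open>simp add: x_def\<close>)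
    show "((\<lambda>pq. ?T (l, pq)) has_sum exp (s * a + t * b + -1 * s * t) *
        (x ^ l / fact l * ito (-1) l l (a + -1 * t) (b + -1 * s))) UNIV" for l
      unfolding prod.case by (rule inner)
  qed (rule outer, use uv in \<open>simp add: x_def\<close>)
  \<comment> \<open>Triples \<open>(l, p, q)\<close> correspond to pairs
    \<open>(l + p, l + q)\<close> together with an index \<open>l\<close> up to their minimum;
    summing over that index restores the second factor.\<close>
  also have "?this \<longleftrightarrow>
      ((\<lambda>((m, n), k). ?T (k, m - k, n - k)) has_sum ?R) (SIGMA (m, n):UNIV. {..min m n})"
    by (rule has_sum_reindex_bij_witness [of _ "\<lambda>((m, n), k). (k, m - k, n - k)"
          "\<lambda>(l, p, q). ((l + p, l + q), l)"]) auto
  finally have "((\<lambda>(m, n). \<Sum>k\<le>min m n. ?T (k, m - k, n - k)) has_sum ?R) UNIV"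
    by (rule has_sum_SigmaD) (auto intro!: has_sum_finiteI)
  also have "(\<lambda>(m, n). \<Sum>k\<le>min m n. ?T (k, m - k, n - k)) =
      (\<lambda>(m, n). u ^ m * v ^ n / (fact m * fact n) * (ito (-1) m n a b * ito (-1) m n c d))"
    unfolding ito_min [of _ _ _ c d] sum_distrib_left
  proof (rule ext, unfold split_paired_all prod.case, rule sum.cong [OF refl])
    fix m n k :: nat assume "k \<in> {..min m n}"
    then have k: "k \<le> m" "k \<le> n" by auto
    then have pw: "u ^ m = u ^ k * u ^ (m - k)" "v ^ n = v ^ k * v ^ (n - k)"
      by (simp_all flip: power_add)
    have mk: "of_nat (m choose k) = (fact m / (fact k * fact (m - k)) :: 'a)"
      and nk: "of_nat (n choose k) = (fact n / (fact k * fact (n - k)) :: 'a)"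
      using k by (simp_all add: binomial_fact)
    show "x ^ k / fact k * (s ^ (m - k) / fact (m - k) * (t ^ (n - k) / fact (n - k))
          * ito (-1) (k + (m - k)) (k + (n - k)) a b) =
        u ^ m * v ^ n / (fact m * fact n) * (ito (-1) m n a b *
          (of_nat (m choose k) * of_nat (n choose k) * fact k * (-1) ^ k * c ^ (m - k) * d ^ (n - k)))"
      using k by (simp add: x_def s_def t_def mk nk pw power_mult_distrib power_minus [of "u * v"] field_simps)
  qed
  finally show ?thesis .
qed

section \<open>Wirtinger derivatives\<close>

text \<open>The derivatives along \<open>1\<close> and \<open>\<i>\<close> are \<open>A + B\<close>
  and \<open>\<i> * (A - B)\<close>. Wirtinger derivatives can thus be read off a real derivative as
  the coefficients of \<open>h\<close> and \<open>cnj h\<close>.\<close>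

lemma wirtinger_eqs:
  assumes "(f has_derivative (\<lambda>h. A * h + B * cnj h)) (at \<zeta>)"
  shows "wirtinger f \<zeta> = A" and "wirtinger_bar f \<zeta> = B"
proof -
  have line: "vector_derivative (\<lambda>t::real. f (\<zeta> + d * of_real t)) (at 0) = A * d + B * cnj d" for d
  proof (rule vector_derivative_at)
    have "((\<lambda>t::real. \<zeta> + d * of_real t) has_derivative (\<lambda>h. d * of_real h)) (at 0)"
      by (auto intro!: derivative_eq_intros)
    then have "((\<lambda>t::real. f (\<zeta> + d * of_real t)) has_derivative
        (\<lambda>h. A * (d * of_real h) + B * cnj (d * of_real h))) (at 0)"
      by (rule has_derivative_compose) (use assms in simp)
    then show "((\<lambda>t::real. f (\<zeta> + d * of_real t)) has_vector_derivative A * d + B * cnj d) (at 0)"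
      by (simp add: has_vector_derivative_def scaleR_conv_of_real algebra_simps)
  qed
  have "partial_x f \<zeta> = A + B"
    using line [of 1] by (simp add: partial_x_def)
  moreover have "partial_y f \<zeta> = A * \<i> - B * \<i>"
    using line [of \<i>] by (simp add: partial_y_def)
  ultimately show "wirtinger f \<zeta> = A" and "wirtinger_bar f \<zeta> = B"
    by (simp_all add: wirtinger_def wirtinger_bar_def right_diff_distrib mult.left_commute)
qed

abbreviation gauss :: "complex \<Rightarrow> complex" where
  "gauss \<xi> \<equiv> exp (- of_real ((cmod \<xi>)\<^sup>2))"

lemma gauss_has_derivative:
  "(gauss has_derivative (\<lambda>h. - (h * cnj \<zeta> + \<zeta> * cnj h) * gauss \<zeta>)) (at \<zeta>)"
proof -
  have "((\<lambda>\<xi>. - (\<xi> * cnj \<xi>)) has_derivative (\<lambda>h. - (\<zeta> * cnj h + h * cnj \<zeta>))) (at \<zeta>)"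
    by (intro has_derivative_minus has_derivative_mult has_derivative_ident has_derivative_cnj)
  then have "((\<lambda>\<xi>. exp (- (\<xi> * cnj \<xi>))) has_derivative
      (\<lambda>h. exp (- (\<zeta> * cnj \<zeta>)) * - (\<zeta> * cnj h + h * cnj \<zeta>))) (at \<zeta>)"
    by (rule has_derivative_compose) (use DERIV_exp in \<open>simp add: has_field_derivative_def\<close>)
  then show ?thesis
    by (simp only: complex_norm_square ac_simps)
qed

text \<open>Induction by \<open>ito_Suc_left\<close>. Only the coefficient of \<open>cnj h\<close>
  is made explicit, since it is what enters \<open>wirtinger_bar\<close>.\<close>

lemma ito_has_derivative:
  "\<exists>A. ((\<lambda>\<xi>. ito e m n \<xi> (cnj \<xi>)) has_derivative
     (\<lambda>h. A * h + of_nat n * ito e m (n - 1) \<zeta> (cnj \<zeta>) * cnj h)) (at \<zeta>)"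
proof (induction m arbitrary: n)
  case 0
  have "((\<lambda>\<xi>. cnj \<xi> ^ n) has_derivative (\<lambda>h. of_nat n * cnj \<zeta> ^ (n - 1) * cnj h)) (at \<zeta>)"
    by (auto intro!: derivative_eq_intros simp: fun_eq_iff)
  then show ?case
    by (intro exI [of _ 0]) simp
next
  case (Suc m)
  obtain A where A: "((\<lambda>\<xi>. ito e m n \<xi> (cnj \<xi>)) has_derivative
     (\<lambda>h. A * h + of_nat n * ito e m (n - 1) \<zeta> (cnj \<zeta>) * cnj h)) (at \<zeta>)"
    using Suc by blast
  obtain A' where A': "((\<lambda>\<xi>. ito e m (n - 1) \<xi> (cnj \<xi>)) has_derivative
     (\<lambda>h. A' * h + of_nat (n - 1) * ito e m (n - 1 - 1) \<zeta> (cnj \<zeta>) * cnj h)) (at \<zeta>)"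
    using Suc by blast
  show ?case
    unfolding ito_Suc_left
    \<comment> \<open>The coefficient of \<open>h\<close> given by the product rule; the
      \<open>cnj h\<close> parts recombine by the recursion at \<open>n - 1\<close>.\<close>
    by (rule exI [of _ "ito e m n \<zeta> (cnj \<zeta>) + \<zeta> * A + e * of_nat n * A'"])
       (rule has_derivative_eq_rhs,
        (rule has_derivative_add has_derivative_mult has_derivative_const has_derivative_ident A A')+,
        simp add: fun_eq_iff algebra_simps)
qed

text \<open>Powers of \<open>cnj \<xi>\<close> act as constants for \<open>wirtinger\<close>, so
  each application only brings down \<open>- cnj \<xi>\<close> from the Gaussian.\<close>

lemma wirtinger_funpow_gauss:
  "(wirtinger ^^ n) gauss = (\<lambda>\<xi>. (-1) ^ n * (cnj \<xi> ^ n * gauss \<xi>))"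
proof (induction n)
  case (Suc n)
  have "wirtinger (\<lambda>\<xi>. (-1) ^ n * (cnj \<xi> ^ n * gauss \<xi>)) \<zeta> = (-1) ^ Suc n * (cnj \<zeta> ^ Suc n * gauss \<zeta>)" for \<zeta>
    by (rule wirtinger_eqs(1) [where B = "(-1) ^ n * (of_nat n * cnj \<zeta> ^ (n - 1) - cnj \<zeta> ^ n * \<zeta>) * gauss \<zeta>"])
       (rule has_derivative_eq_rhs,
        (rule gauss_has_derivative has_derivative_mult has_derivative_const has_derivative_power
          has_derivative_cnj has_derivative_ident)+,
        simp add: fun_eq_iff algebra_simps)
  then show ?case
    by (simp only: Suc funpow.simps comp_apply)
qed simp

text \<open>Differentiating the product gives
  \<open>n * ito (-1) m (n - 1) - \<xi> * ito (-1) m n\<close> times the Gaussian, which is minus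
  the recursion \<open>ito_Suc_left\<close> at \<open>e = -1\<close>.\<close>

lemma wirtinger_bar_funpow_gauss:
  "(wirtinger_bar ^^ m) (\<lambda>\<xi>. (-1) ^ n * (cnj \<xi> ^ n * gauss \<xi>)) =
     (\<lambda>\<xi>. (-1) ^ (m + n) * (ito (-1) m n \<xi> (cnj \<xi>) * gauss \<xi>))"
proof (induction m)
  case (Suc m)
  have "wirtinger_bar (\<lambda>\<xi>. (-1) ^ (m + n) * (ito (-1) m n \<xi> (cnj \<xi>) * gauss \<xi>)) \<zeta>
      = (-1) ^ (Suc m + n) * (ito (-1) (Suc m) n \<zeta> (cnj \<zeta>) * gauss \<zeta>)" for \<zeta>
  proof -
    obtain A where A: "((\<lambda>\<xi>. ito (-1) m n \<xi> (cnj \<xi>)) has_derivative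
       (\<lambda>h. A * h + of_nat n * ito (-1) m (n - 1) \<zeta> (cnj \<zeta>) * cnj h)) (at \<zeta>)"
      using ito_has_derivative by blast
    show ?thesis
      by (rule wirtinger_eqs(2) [where
            A = "(-1) ^ (m + n) * (A - ito (-1) m n \<zeta> (cnj \<zeta>) * cnj \<zeta>) * gauss \<zeta>"])
         (rule has_derivative_eq_rhs,
          (rule gauss_has_derivative has_derivative_mult has_derivative_const A)+,
          simp add: fun_eq_iff ito_Suc_left algebra_simps)
  qed
  then show ?case
    by (simp only: Suc funpow.simps comp_apply)
qed simp

lemma complex_hermite_eq_ito: "complex_hermite m n \<zeta> = ito (-1) m n \<zeta> (cnj \<zeta>)"
proof -
  have "complex_hermite m n \<zeta> = ((-1) ^ (m + n) * (-1) ^ (m + n)) *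
      (exp (of_real ((cmod \<zeta>)\<^sup>2)) * gauss \<zeta>) * ito (-1) m n \<zeta> (cnj \<zeta>)"
    unfolding complex_hermite_def wirtinger_funpow_gauss wirtinger_bar_funpow_gauss
    by (simp only: mult_ac)
  then show ?thesis
    by (simp add: exp_minus_inverse flip: power_mult_distrib)
qed

theorem proposition3p25:
  fixes u v z w :: complex
  assumes "cmod (u * v) < 1"
  shows "(\<forall>m. summable (\<lambda>n. u ^ m * v ^ n / (fact m * fact n) * complex_hermite2 m n m n z w)) \<and>
    (\<lambda>m. \<Sum>n. u ^ m * v ^ n / (fact m * fact n) * complex_hermite2 m n m n z w) sums
      (1 / (1 - u * v) *
       exp (((u + v - 2 * u * v) * of_real ((cmod z)\<^sup>2)
             - (u + v + 2 * u * v) * of_real ((cmod w)\<^sup>2)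
             + 2 * \<i> * (u - v) * of_real (Re (z * cnj w))) / (1 - u * v)))"
    (is "(\<forall>m. summable (?f m)) \<and> _ sums ?S")
proof -
  \<comment> \<open>\<open>b\<close> and \<open>d\<close> are the conjugates of \<open>a\<close> and
    \<open>c\<close>: the second arguments left implicit in \<open>complex_hermite2\<close>.\<close>
  define a b c d where "a = z + \<i> * w" and "b = cnj z - \<i> * cnj w"
    and "c = cnj z + \<i> * cnj w" and "d = z - \<i> * w"
  have f: "?f = (\<lambda>m n. u ^ m * v ^ n / (fact m * fact n) * (ito (-1) m n a b * ito (-1) m n c d))"
    by (simp add: complex_hermite2_def complex_hermite_eq_ito a_def b_def c_def d_def)
  have re: "2 * \<i> * x * of_real (Re (z * cnj w)) = \<i> * x * (z * cnj w + cnj z * w)" for x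
    using complex_add_cnj [of "z * cnj w"] by (simp add: mult_ac)
  have "(u + v - 2 * u * v) * of_real ((cmod z)\<^sup>2) - (u + v + 2 * u * v) * of_real ((cmod w)\<^sup>2)
        + 2 * \<i> * (u - v) * of_real (Re (z * cnj w))
      = (u + v - 2 * u * v) * (z * cnj z) - (u + v + 2 * u * v) * (w * cnj w)
        + \<i> * (u - v) * (z * cnj w + cnj z * w)"
    by (simp only: complex_norm_square re)
  also have "\<dots> = u * a * c + v * b * d - u * v * (a * b + c * d)"
    by (simp add: a_def b_def c_def d_def algebra_simps)
  finally have S: "((\<lambda>(m, n). ?f m n) has_sum ?S) (UNIV \<times> UNIV)"
    using ito_mehler [OF assms, of a b c d] unfolding f by simp
  \<comment> \<open>The unordered sum over pairs yields the summability of each row and the iterated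
    value; both are then read as ordered series.\<close>
  have row: "?f m summable_on UNIV" for m
    using summable_on_SigmaD1 [OF has_sum_imp_summable [OF S], of m] by simp
  have "((\<lambda>m. infsum (?f m) UNIV) has_sum ?S) UNIV"
    by (rule has_sum_SigmaD [OF S]) (use row in auto)
  moreover have "infsum (?f m) UNIV = suminf (?f m)" for m
    using has_sum_imp_sums [OF has_sum_infsum [OF row]] by (simp add: sums_iff)
  ultimately show ?thesis
    using row summable_on_imp_summable has_sum_imp_sums by auto
qed

end
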